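(* Let $n\ge 1$, let $c_1,\dots,c_n\ge 0$ be costs, and let $D_1,\dots,D_n$ and $D'_1,\dots,D'_n$ be continuous probability distributions supported on $[0,1]$. Let $\sigma=(\sigma_1,\dots,\sigma_n)$ with $\sigma_i=\sigma(D_i,c_i)$ be the reservation prices computed from $\mathbf D=(D_1,\dots,D_n)$. Assume that $d_K(D_i,D'_i)\le\epsilon$ for all $i$. Then $$\bigl|W_{\sigma}(\mathbf D)-W_{\sigma}(\mathbf D')\bigr|\le O(n\epsilon),$$ i.e. there is an absolute constant $C$ such that the left-hand side is at most $Cn\epsilon$.
   Context: Pandora's box problem: there are $n$ boxes; box $i$ has a known cost $c_i\ge 0$ and a value $X_i$ drawn independently from a distribution $D_i$ on $[0,1]$. An algorithm adaptively opens boxes (paying $c_i$ for each opened box $i$) and finally keeps the value of one opened box (or $0$ if no box was opened); its utility is the kept value minus the sum of costs of opened boxes. The reservation price $\sigma(D,c)$ of a box with value distribution $D$ and cost $c$ is the number $\sigma$ satisfying $\mathbb E_{X\sim D}[\max\{X-\sigma,0\}]=c$. For a vector $\tau=(\tau_1,\dots,\tau_n)$ of reals, $\mathrm{alg}_\tau$ is the algorithm that opens boxes in decreasing order of $\tau_i$, and stops (before opening the next box $j$ in this order) when the maximum among the already observed values exceeds $\tau_j$, or when all boxes have been opened; it then keeps the highest value seen (or $0$ if no box was opened). $W_\tau(\mathbf D)=W_\tau(D_1,\dots,D_n)$ denotes the expected utility of $\mathrm{alg}_\tau$ when $X_i\sim D_i$ independently (with the fixed costs $c_i$). The Kolmogorov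 distance between distributions $D,D'$ on $[0,1]$ is $d_K(D,D')=\sup_{z\in[0,1]}|F_D(z)-F_{D'}(z)|$, where $F$ denotes the cumulative distribution function. *)

theory Defs
  imports "HOL-Probability.Probability"
begin

text \<open>``Continuous'' means that the distribution function is continuous, i.e. that there are
  no atoms; a density is not required.\<close>

definition continuous_distribution01 :: "real measure \<Rightarrow> bool" where
  "continuous_distribution01 D \<longleftrightarrow>
     real_distribution D \<and> measure D {0..1} = 1 \<and> continuous_on UNIV (cdf D)"

definition kolmogorov_dist :: "real measure \<Rightarrow> real measure \<Rightarrow> real" where
  "kolmogorov_dist D D' = (SUP z\<in>{0..1}. \<bar>cdf D z - cdf D' z\<bar>)"

text \<open>A predicate rather than a function: for cost 0 the defining equation has more than one
  solution (every upper bound of the support), and none of them is singled out.\<close>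

definition is_reservation_price :: "real measure \<Rightarrow> real \<Rightarrow> real \<Rightarrow> bool" where
  "is_reservation_price D c s \<longleftrightarrow> (\<integral>x. max (x - s) 0 \<partial>D) = c"

text \<open>The orders in which the algorithm for \<open>\<tau>\<close> may open the boxes \<open>{..<n}\<close>; the order is
  unique up to breaking ties between equal entries of \<open>\<tau>\<close>.\<close>

definition decreasing_order :: "nat \<Rightarrow> (nat \<Rightarrow> real) \<Rightarrow> nat list \<Rightarrow> bool" where
  "decreasing_order n \<tau> ord \<longleftrightarrow>
     distinct ord \<and> set ord = {..<n} \<and> sorted_wrt (\<lambda>i j. \<tau> i \<ge> \<tau> j) ord"

text \<open>The highest observed value when \<open>S\<close> is the set of opened boxes. Before any box has been
  opened it is the outside option 0; so no box at all is opened if all entries of \<open>\<tau>\<close>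
  are negative.\<close>

definition best_value :: "(nat \<Rightarrow> real) \<Rightarrow> nat set \<Rightarrow> real" where
  "best_value x S = (if S = {} then 0 else Max (x ` S))"

text \<open>\<open>opened_boxes \<tau> x S js\<close> is the set of boxes that are open in the end when the values
  are \<open>x\<close>, the boxes in \<open>S\<close> are already open, and \<open>js\<close> are the boxes still to come.\<close>

fun opened_boxes :: "(nat \<Rightarrow> real) \<Rightarrow> (nat \<Rightarrow> real) \<Rightarrow> nat set \<Rightarrow> nat list \<Rightarrow> nat set" where
  "opened_boxes \<tau> x S [] = S"
| "opened_boxes \<tau> x S (j # js) =
     (if best_value x S > \<tau> j then S else opened_boxes \<tau> x (insert j S) js)"

definition alg_utility ::
    "(nat \<Rightarrow> real) \<Rightarrow> (nat \<Rightarrow> real) \<Rightarrow> nat list \<Rightarrow> (nat \<Rightarrow> real) \<Rightarrow> real" where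
  "alg_utility c \<tau> ord x =
     (let S = opened_boxes \<tau> x {} ord in best_value x S - (\<Sum>i\<in>S. c i))"

definition expected_utility ::
    "nat \<Rightarrow> (nat \<Rightarrow> real) \<Rightarrow> (nat \<Rightarrow> real) \<Rightarrow> nat list \<Rightarrow> (nat \<Rightarrow> real measure) \<Rightarrow> real" where
  "expected_utility n c \<tau> ord D = (\<integral>x. alg_utility c \<tau> ord x \<partial>(PiM {..<n} D))"

end

theory Submission
  imports Defs
begin

text \<open>The distributions are exchanged one box at a time, in the order of opening, so that the boxes
  after the exchanged one still have the distributions from which \<open>\<sigma>\<close> was computed. For those boxes
  the expected value of continuing with best observation \<open>y\<close> is increasing in \<open>y\<close>, lies in \<open>{0..1}\<close>
  for \<open>y \<in> {0..1}\<close>, and equals \<open>y\<close> above all reservation prices. Hence the exchange compares the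
  integrals of one increasing function into \<open>{0..1}\<close> under \<open>D j\<close> and \<open>D' j\<close>, which differ by at most
  the Kolmogorov distance, because such a function is an average of indicators of up-sets. This
  gives the bound with \<open>C = 1\<close>.\<close>

section \<open>Distributions on the unit interval\<close>

lemma continuous_distribution01D:
  assumes "continuous_distribution01 D"
  shows "real_distribution D" and "AE x in D. x \<in> {0..1}" and "measure D {x} = 0"
proof -
  show rd: "real_distribution D"
    using assms by (simp add: continuous_distribution01_def)
  then interpret real_distribution D .
  show "AE x in D. x \<in> {0..1}"
    using assms by (intro AE_prob_1) (simp add: continuous_distribution01_def)
  have "isCont (cdf D) x"
    using assms by (simp add: continuous_distribution01_def continuous_on_eq_continuous_at)
  then show "measure D {x} = 0"
    by (simp add: isCont_cdf)
qed

lemma distribution01_integral: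
  assumes D: "continuous_distribution01 D"
    and h: "h \<in> borel_measurable borel"
    and bd: "\<And>x. x \<in> {0..1} \<Longrightarrow> a \<le> h x \<and> h x \<le> (b::real)"
  shows "integrable D h" and "a \<le> (\<integral>x. h x \<partial>D)" and "(\<integral>x. h x \<partial>D) \<le> b"
proof -
  interpret real_distribution D
    using D by (rule continuous_distribution01D)
  have ae: "AE x in D. a \<le> h x \<and> h x \<le> b"
    using continuous_distribution01D(2)[OF D] by eventually_elim (rule bd)
  show int: "integrable D h"
  proof (rule integrable_const_bound)
    show "AE x in D. norm (h x) \<le> \<bar>a\<bar> + \<bar>b\<bar>"
      using ae by eventually_elim auto
    show "h \<in> borel_measurable D" using h by simp
  qed
  show "a \<le> (\<integral>x. h x \<partial>D)"
    using ae by (intro integral_ge_const int) auto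
  show "(\<integral>x. h x \<partial>D) \<le> b"
    using ae by (intro integral_le_const int) auto
qed

lemma distribution01_integral_mono:
  assumes D: "continuous_distribution01 D"
    and "integrable D f" "integrable D (g :: real \<Rightarrow> real)"
    and le: "\<And>x. x \<in> {0..1} \<Longrightarrow> f x \<le> g x"
  shows "(\<integral>x. f x \<partial>D) \<le> (\<integral>x. g x \<partial>D)"
proof (rule integral_mono_AE)
  show "AE x in D. f x \<le> g x"
    using continuous_distribution01D(2)[OF D] by eventually_elim (rule le)
qed fact+

lemma distribution01_integral_cong:
  assumes D: "continuous_distribution01 D"
    and "f \<in> borel_measurable borel" "(g :: real \<Rightarrow> real) \<in> borel_measurable borel"
    and eq: "\<And>x. x \<in> {0..1} \<Longrightarrow> f x = g x"
  shows "(\<integral>x. f x \<partial>D) = (\<integral>x. g x \<partial>D)"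
proof (rule integral_cong_AE)
  interpret real_distribution D
    using D by (rule continuous_distribution01D)
  show "f \<in> borel_measurable D" "g \<in> borel_measurable D"
    using assms by simp_all
  show "AE x in D. f x = g x"
    using continuous_distribution01D(2)[OF D] by eventually_elim (rule eq)
qed

section \<open>Kolmogorov distance tested on up-sets and on increasing functions\<close>

lemma cdf_diff_le_kolmogorov_dist:
  assumes D: "continuous_distribution01 D" and D': "continuous_distribution01 D'"
    and z: "z \<in> {0..1}"
  shows "\<bar>cdf D z - cdf D' z\<bar> \<le> kolmogorov_dist D D'"
proof -
  interpret D: real_distribution D using D by (rule continuous_distribution01D)
  interpret D': real_distribution D' using D' by (rule continuous_distribution01D)
  have "\<bar>cdf D x - cdf D' x\<bar> \<le> 1" for x
    using D.cdf_nonneg[of x] D'.cdf_nonneg[of x] D.cdf_bounded_prob[of x] D'.cdf_bounded_prob[of x]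
    by linarith
  then have "bdd_above ((\<lambda>z. \<bar>cdf D z - cdf D' z\<bar>) ` {0..1})"
    by (intro bdd_aboveI2[where M=1])
  then show ?thesis
    unfolding kolmogorov_dist_def using z by (intro cSUP_upper)
qed

text \<open>Inside the unit interval an up-set is a ray above its infimum, and without atoms it does
  not matter whether the endpoint belongs to it. The infimum is taken over
  \<open>U \<inter> {0..1}\<close> because \<open>U\<close> may be unbounded below and because the
  Kolmogorov distance looks at points of \<open>{0..1}\<close> only.\<close>

lemma measure_up_set_eq_cdf:
  assumes D: "continuous_distribution01 D"
    and U: "U \<in> sets borel" and up: "\<And>x z. x \<in> U \<Longrightarrow> x \<le> z \<Longrightarrow> z \<in> U"
    and ne: "U \<inter> {0..1} \<noteq> {}"
  shows "measure D U = 1 - cdf D (Inf (U \<inter> {0..1}))"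
proof -
  interpret real_distribution D using D by (rule continuous_distribution01D)
  let ?a = "Inf (U \<inter> {0..1})"
  have "AE x in D. x \<noteq> ?a"
    using continuous_distribution01D(3)[OF D, of ?a]
    by (subst AE_iff_measurable[where N="{?a}"]) (auto simp: emeasure_eq_measure)
  then have "AE x in D. x \<in> U \<longleftrightarrow> x \<in> {?a<..}"
    using continuous_distribution01D(2)[OF D]
  proof eventually_elim
    case (elim x)
    show ?case
    proof
      assume "x \<in> U"
      with elim have "?a \<le> x" by (intro cInf_lower) auto
      with elim show "x \<in> {?a<..}" by auto
    next
      assume "x \<in> {?a<..}"
      then obtain u where "u \<in> U" "u < x"
        using cInf_lessD[OF ne, of x] by auto
      then show "x \<in> U" using up[of u x] by simp
    qed
  qed
  then have "measure D U = measure D {?a<..}"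
    using U by (intro finite_measure_eq_AE) auto
  also have "\<dots> = measure D (space D - {..?a})"
    by (intro arg_cong[where f="measure D"]) auto
  also have "\<dots> = 1 - cdf D ?a"
    by (subst prob_compl) (auto simp: cdf_def2)
  finally show ?thesis .
qed

text \<open>The endpoint of the ray depends on \<open>U\<close> alone, so one and the same point of
  \<open>{0..1}\<close> serves both distributions.\<close>

lemma measure_up_set_diff_le:
  assumes D: "continuous_distribution01 D" and D': "continuous_distribution01 D'"
    and U: "U \<in> sets borel" and up: "\<And>x z. x \<in> U \<Longrightarrow> x \<le> z \<Longrightarrow> z \<in> U"
  shows "\<bar>measure D U - measure D' U\<bar> \<le> kolmogorov_dist D D'"
proof (cases "U \<inter> {0..1} = {}")
  case True
  have null: "measure E U = 0" if E: "continuous_distribution01 E" for E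
  proof -
    interpret real_distribution E using E by (rule continuous_distribution01D)
    have "AE x in E. x \<in> U \<longleftrightarrow> x \<in> {}"
      using continuous_distribution01D(2)[OF E] by eventually_elim (use True in auto)
    then have "measure E U = measure E {}"
      using U by (intro finite_measure_eq_AE) auto
    then show ?thesis by simp
  qed
  \<comment> \<open>The point \<open>0\<close> serves only to show that the distance is
    nonnegative.\<close>
  show ?thesis
    using null[OF D] null[OF D'] cdf_diff_le_kolmogorov_dist[OF D D', of 0] by simp
next
  case False
  let ?a = "Inf (U \<inter> {0..1})"
  have "0 \<le> ?a" using False by (intro cInf_greatest) auto
  moreover have "?a \<le> 1"
  proof -
    obtain u where u: "u \<in> U \<inter> {0..1}" using False by blast
    then have "?a \<le> u" by (intro cInf_lower) auto
    with u show ?thesis by auto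
  qed
  ultimately have "\<bar>cdf D ?a - cdf D' ?a\<bar> \<le> kolmogorov_dist D D'"
    by (intro cdf_diff_le_kolmogorov_dist[OF D D']) simp
  then show ?thesis
    using measure_up_set_eq_cdf[OF D U up False] measure_up_set_eq_cdf[OF D' U up False] by simp
qed

text \<open>The number of thresholds \<open>k / N\<close> that are at most \<open>t\<close> is the
  floor of \<open>N * t\<close>, so \<open>s\<close> is \<open>t\<close> rounded down to a multiple
  of \<open>1 / N\<close>.\<close>

lemma staircase_bounds:
  fixes t :: real
  assumes t: "0 \<le> t" "t \<le> 1" and N: "N > 0"
  defines "s \<equiv> (\<Sum>k=1..N. if real k / real N \<le> t then 1 else 0) / real N"
  shows "t - 1 / real N \<le> s" and "s \<le> t"
proof -
  have "{k \<in> {1..N}. real k / real N \<le> t} = {1..nat \<lfloor>real N * t\<rfloor>}"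
  proof -
    have "k \<le> N" if "real k \<le> real N * t" for k
    proof -
      have "real N * t \<le> real N" using t by (simp add: mult_left_le)
      with that show ?thesis by linarith
    qed
    then show ?thesis
      using N t by (auto simp: divide_le_eq le_nat_floor mult.commute le_nat_iff le_floor_iff)
  qed
  then have "s = real (nat \<lfloor>real N * t\<rfloor>) / real N"
    unfolding s_def by (simp add: sum.If_cases Int_def)
  also have "\<dots> = of_int \<lfloor>real N * t\<rfloor> / real N"
    using t by simp
  finally have s: "real N * s = of_int \<lfloor>real N * t\<rfloor>" using N by simp
  then have "real N * s \<le> real N * t" by linarith
  then show "s \<le> t" using N by simp
  have "real N * t - 1 \<le> real N * s" using s by linarith
  then show "t - 1 / real N \<le> s" using N by (simp add: field_simps)
qed

text \<open>A discrete layer-cake argument: up to \<open>1 / N\<close>, \<open>g\<close> is on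
  \<open>{0..1}\<close> the average of the indicators of its superlevel sets \<open>U N k\<close>,
  which are up-sets by monotonicity. Averaging costs no factor, so the bound for a single up-set
  carries over.\<close>

lemma integral_mono_diff_le_kolmogorov_dist:
  fixes g :: "real \<Rightarrow> real"
  assumes D: "continuous_distribution01 D" and D': "continuous_distribution01 D'"
    and mono: "mono g" and g: "\<And>x. x \<in> {0..1} \<Longrightarrow> g x \<in> {0..1}"
  shows "\<bar>(\<integral>x. g x \<partial>D) - (\<integral>x. g x \<partial>D')\<bar> \<le> kolmogorov_dist D D'"
proof -
  let ?d = "kolmogorov_dist D D'"
  have gm[measurable]: "g \<in> borel_measurable borel"
    using mono by (rule borel_measurable_mono)
  define U where "U N k = {x. real k / real N \<le> g x}" for N k :: nat
  have Um[measurable]: "U N k \<in> sets borel" for N k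
    unfolding U_def by measurable
  define s where "s N x = (\<Sum>k=1..N. indicator (U N k) x) / real N" for N x
  have sm: "s N \<in> borel_measurable borel" for N
    unfolding s_def by measurable
  have s: "g x - 1 / real N \<le> s N x \<and> s N x \<le> g x" if "N > 0" "x \<in> {0..1}" for N x
  proof -
    have "s N x = (\<Sum>k=1..N. if real k / real N \<le> g x then 1 else 0) / real N"
      unfolding s_def U_def by (intro arg_cong2[where f="(/)"] sum.cong) (auto simp: indicator_def)
    then show ?thesis
      using staircase_bounds[of "g x" N] g[of x] that by auto
  qed
  have s_int: "(\<integral>x. s N x \<partial>E) = (\<Sum>k=1..N. measure E (U N k)) / real N"
    if E: "continuous_distribution01 E" for E N
  proof -
    interpret real_distribution E using E by (rule continuous_distribution01D)
    show ?thesis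
      unfolding s_def by (simp add: Bochner_Integration.integral_sum emeasure_eq_measure)
  qed
  have approx: "\<bar>(\<integral>x. g x \<partial>E) - (\<integral>x. s N x \<partial>E)\<bar> \<le> 1 / real N"
    if E: "continuous_distribution01 E" and N: "N > 0" for E N
  proof -
    have gi: "integrable E g"
      using g by (intro distribution01_integral[OF E gm, of 0 1]) auto
    have si: "integrable E (s N)"
    proof (rule distribution01_integral[OF E sm])
      fix x :: real assume "x \<in> {0..1}"
      with s[OF N this] g[OF this] show "- 1 / real N \<le> s N x \<and> s N x \<le> 1" by auto
    qed
    have "(\<lambda>x. g x - s N x) \<in> borel_measurable borel"
      using sm[of N] by measurable
    then have "0 \<le> (\<integral>x. g x - s N x \<partial>E)" "(\<integral>x. g x - s N x \<partial>E) \<le> 1 / real N"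
      using s[OF N] by (intro distribution01_integral[OF E, of _ 0 "1 / real N"]; fastforce)+
    then show ?thesis
      using gi si by simp
  qed
  have step: "\<bar>(\<integral>x. s N x \<partial>D) - (\<integral>x. s N x \<partial>D')\<bar> \<le> ?d" if N: "N > 0" for N
  proof -
    have "\<bar>\<Sum>k=1..N. measure D (U N k) - measure D' (U N k)\<bar>
        \<le> (\<Sum>k=1..N. \<bar>measure D (U N k) - measure D' (U N k)\<bar>)"
      by (rule sum_abs)
    also have "\<dots> \<le> (\<Sum>k=1..N. ?d)"
    proof (intro sum_mono measure_up_set_diff_le[OF D D' Um])
      fix k x z assume "x \<in> U N k" "x \<le> z"
      then show "z \<in> U N k"
        using monoD[OF mono, of x z] by (auto simp: U_def)
    qed
    also have "\<dots> = real N * ?d" by simp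
    finally show ?thesis
      using N by (simp add: s_int[OF D] s_int[OF D'] sum_subtractf flip: diff_divide_distrib)
        (simp add: field_simps)
  qed
  show ?thesis
  proof (rule field_le_epsilon)
    fix e :: real assume "e > 0"
    \<comment> \<open>The approximation error occurs once for each of the two distributions, hence
      \<open>e / 2\<close>.\<close>
    then obtain m where m: "inverse (real (Suc m)) < e / 2"
      using reals_Archimedean[of "e / 2"] by auto
    have "1 / real (Suc m) < e / 2" using m by (simp add: inverse_eq_divide)
    then show "\<bar>(\<integral>x. g x \<partial>D) - (\<integral>x. g x \<partial>D')\<bar> \<le> ?d + e"
      using approx[OF D, of "Suc m"] approx[OF D', of "Suc m"] step[of "Suc m"] by linarith
  qed
qed

section \<open>The value of continuing from a given best observation\<close>

text \<open>Expected final value minus the costs still to be paid, when \<open>y\<close> is the best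
  observation and the boxes \<open>js\<close> remain. Costs already paid are left out, so that the
  state is the single number \<open>y\<close>; iterated integrals let the boxes be treated one by
  one along the list.\<close>

fun continuation_value ::
    "(nat \<Rightarrow> real) \<Rightarrow> (nat \<Rightarrow> real) \<Rightarrow> (nat \<Rightarrow> real measure) \<Rightarrow> nat list \<Rightarrow> real \<Rightarrow> real" where
  "continuation_value c \<tau> D [] y = y"
| "continuation_value c \<tau> D (j # js) y =
     (if y > \<tau> j then y else (\<integral>x. continuation_value c \<tau> D js (max y x) \<partial>D j) - c j)"

text \<open>A crude a priori bound, used only to secure integrability; the final estimate does not
  contain it.\<close>

definition total_cost :: "(nat \<Rightarrow> real) \<Rightarrow> nat list \<Rightarrow> real" where
  "total_cost c js = (\<Sum>j\<leftarrow>js. \<bar>c j\<bar>)"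

lemma total_cost_simps [simp]:
  "total_cost c [] = 0" "total_cost c (j # js) = \<bar>c j\<bar> + total_cost c js"
  by (simp_all add: total_cost_def)

lemma total_cost_nonneg: "0 \<le> total_cost c js"
  by (induction js) auto

lemma continuation_value_cong:
  "(\<And>j. j \<in> set js \<Longrightarrow> D j = D' j) \<Longrightarrow>
    continuation_value c \<tau> D js y = continuation_value c \<tau> D' js y"
  by (induction js arbitrary: y) auto

lemma continuation_value_measurable:
  assumes "\<And>j. j \<in> set js \<Longrightarrow> continuous_distribution01 (D j)"
  shows "continuation_value c \<tau> D js \<in> borel_measurable borel"
  using assms
proof (induction js)
  case Nil
  then show ?case by (simp add: measurable_ident_sets[unfolded id_def])
next
  case (Cons j js)
  \<comment> \<open>Supplies the sigma-finiteness that makes the integral over \<open>D j\<close>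
    measurable in the parameter \<open>y\<close>.\<close>
  interpret real_distribution "D j"
    using Cons.prems[of j] by (simp add: continuous_distribution01D)
  have [measurable]: "continuation_value c \<tau> D js \<in> borel_measurable borel"
    using Cons by simp
  show ?case
    by (subst continuation_value.simps[abs_def]) measurable
qed

lemma continuation_value_bounded:
  assumes "\<And>j. j \<in> set js \<Longrightarrow> continuous_distribution01 (D j)" and "y \<in> {0..1}"
  shows "\<bar>continuation_value c \<tau> D js y\<bar> \<le> 1 + total_cost c js"
  using assms
proof (induction js arbitrary: y)
  case Nil
  then show ?case by simp
next
  case (Cons j js)
  let ?h = "\<lambda>x. continuation_value c \<tau> D js (max y x)" and ?b = "1 + total_cost c js"
  have [measurable]: "continuation_value c \<tau> D js \<in> borel_measurable borel"
    using Cons.prems by (intro continuation_value_measurable) simp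
  have "?h \<in> borel_measurable borel" by measurable
  moreover have "- ?b \<le> ?h x \<and> ?h x \<le> ?b" if "x \<in> {0..1}" for x
  proof -
    have "\<bar>?h x\<bar> \<le> ?b" using that Cons.prems by (intro Cons.IH) auto
    then show ?thesis by linarith
  qed
  ultimately have "- ?b \<le> (\<integral>x. ?h x \<partial>D j)" "(\<integral>x. ?h x \<partial>D j) \<le> ?b"
    using Cons.prems by (intro distribution01_integral[of "D j" ?h "- ?b" ?b]; simp)+
  then show ?case
    using Cons.prems(2) total_cost_nonneg[of c js] by auto
qed

lemma continuation_value_integrable:
  assumes "\<And>j. j \<in> set js \<Longrightarrow> continuous_distribution01 (D j)" and "y \<in> {0..1}"
    and E: "continuous_distribution01 E"
  shows "integrable E (\<lambda>x. continuation_value c \<tau> D js (max y x))"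
proof -
  let ?h = "\<lambda>x. continuation_value c \<tau> D js (max y x)" and ?b = "1 + total_cost c js"
  have [measurable]: "continuation_value c \<tau> D js \<in> borel_measurable borel"
    using assms by (intro continuation_value_measurable) simp
  have "?h \<in> borel_measurable borel" by measurable
  moreover have "- ?b \<le> ?h x \<and> ?h x \<le> ?b" if "x \<in> {0..1}" for x
  proof -
    have "\<bar>?h x\<bar> \<le> ?b" using that assms by (intro continuation_value_bounded) auto
    then show ?thesis by linarith
  qed
  ultimately show ?thesis
    by (rule distribution01_integral[OF E])
qed

section \<open>Optimal continuation\<close>

lemma integrable_mono_distribution01:
  fixes f :: "real \<Rightarrow> real"
  assumes E: "continuous_distribution01 E" and "mono f"
  shows "integrable E f"
  using distribution01_integral(1)[OF E borel_measurable_mono[OF \<open>mono f\<close>], of "f 0" "f 1"]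
    monoD[OF \<open>mono f\<close>] by auto

text \<open>Opening box \<open>j\<close> is worth the same as receiving \<open>min X \<sigma>\<close> for free: the overshoot
  \<open>max (X - \<sigma>) 0\<close>, after which the algorithm stops, pays for the cost on average.\<close>

lemma integral_capped:
  fixes f :: "real \<Rightarrow> real"
  assumes E: "continuous_distribution01 E" and price: "is_reservation_price E k s"
    and mono: "mono f" and fix_above: "\<And>z. s \<le> z \<Longrightarrow> f z = z" and y: "y \<le> s"
  shows "(\<integral>x. f (max y x) \<partial>E) - k = (\<integral>x. f (max y (min x s)) \<partial>E)"
proof -
  have "mono (\<lambda>x. f (max y x))"
    by (intro monoI monoD[OF mono]) auto
  moreover have "mono (\<lambda>x. max (x - s) 0)"
    by (rule monoI) auto
  ultimately have "integrable E (\<lambda>x. f (max y x))" "integrable E (\<lambda>x. max (x - s) 0)"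
    by (simp_all add: integrable_mono_distribution01[OF E])
  then have "(\<integral>x. f (max y x) \<partial>E) - k = (\<integral>x. f (max y x) - max (x - s) 0 \<partial>E)"
    using price by (simp add: is_reservation_price_def)
  \<comment> \<open>The integrands agree pointwise: for \<open>x \<le> s\<close> the overshoot
    vanishes, and for \<open>x > s\<close> the left one is \<open>x - (x - s) = s = f s\<close>,
    where \<open>max y s = s\<close>.\<close>
  also have "\<dots> = (\<integral>x. f (max y (min x s)) \<partial>E)"
    using y by (intro Bochner_Integration.integral_cong) (auto simp: min_def max_def fix_above)
  finally show ?thesis .
qed

text \<open>By \<open>integral_capped\<close>, opening box \<open>j\<close> amounts to averaging the
  later continuation over \<open>max y (min x (\<sigma> j))\<close> with no cost left over, and the
  properties pass through this integral. They are proved together because the capped form for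
  \<open>j\<close> uses monotonicity and the third property for the later boxes. The third one
  allows equality: a box whose price equals \<open>y\<close> is opened and on average gains exactly
  its cost.\<close>

lemma continuation_value_optimal:
  assumes "\<And>j. j \<in> set js \<Longrightarrow> continuous_distribution01 (D j)"
    and "\<And>j. j \<in> set js \<Longrightarrow> is_reservation_price (D j) (c j) (\<sigma> j)"
    and "sorted_wrt (\<lambda>i j. \<sigma> i \<ge> \<sigma> j) js"
  shows "mono (continuation_value c \<sigma> D js)"
    and "\<And>y. y \<le> continuation_value c \<sigma> D js y"
    and "\<And>y. (\<And>j. j \<in> set js \<Longrightarrow> \<sigma> j \<le> y) \<Longrightarrow> continuation_value c \<sigma> D js y = y"
    and "\<And>y. 1 \<le> y \<Longrightarrow> continuation_value c \<sigma> D js y = y"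
proof -
  let ?V = "continuation_value c \<sigma> D"
  have "mono (?V js) \<and> (\<forall>y. y \<le> ?V js y) \<and> (\<forall>y. (\<forall>j\<in>set js. \<sigma> j \<le> y) \<longrightarrow> ?V js y = y)
      \<and> (\<forall>y\<ge>1. ?V js y = y)"
    using assms
  proof (induction js)
    case Nil
    then show ?case by (simp add: mono_def)
  next
    case (Cons j js)
    let ?E = "D j"
    have E: "continuous_distribution01 ?E" and price: "is_reservation_price ?E (c j) (\<sigma> j)"
      using Cons.prems by simp_all
    interpret real_distribution ?E using E by (rule continuous_distribution01D)
    have IH: "mono (?V js) \<and> (\<forall>y. y \<le> ?V js y)
        \<and> (\<forall>y. (\<forall>j\<in>set js. \<sigma> j \<le> y) \<longrightarrow> ?V js y = y) \<and> (\<forall>y\<ge>1. ?V js y = y)"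
      by (rule Cons.IH) (use Cons.prems in simp_all)
    then have mono: "mono (?V js)" and ge: "\<And>y. y \<le> ?V js y"
      and fix1: "\<And>y. (\<forall>j\<in>set js. \<sigma> j \<le> y) \<Longrightarrow> ?V js y = y"
      and fix2: "\<And>y. 1 \<le> y \<Longrightarrow> ?V js y = y"
      by blast+
    \<comment> \<open>Here the decreasing order enters: \<open>\<sigma> j\<close> bounds all later
      prices, as \<open>integral_capped\<close> requires.\<close>
    have fix_above: "?V js z = z" if "\<sigma> j \<le> z" for z
    proof (intro fix1 ballI)
      fix i assume "i \<in> set js"
      then have "\<sigma> i \<le> \<sigma> j" using Cons.prems(3) by simp
      then show "\<sigma> i \<le> z" using that by simp
    qed
    have mono': "mono (\<lambda>x. ?V js (max y (min x (\<sigma> j))))" for y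
      by (intro monoI monoD[OF mono] max.mono min.mono order_refl)
    have int: "integrable ?E (\<lambda>x. ?V js (max y (min x (\<sigma> j))))" for y
      by (rule integrable_mono_distribution01[OF E mono'])
    have meas: "(\<lambda>x. ?V js (max y (min x (\<sigma> j)))) \<in> borel_measurable borel" for y
      by (rule borel_measurable_mono[OF mono'])
    \<comment> \<open>The capped form also covers the stopping case, where the cap keeps the
      integrand constant; thus no case distinction on \<open>y\<close> remains below.\<close>
    have V: "?V (j # js) y = (\<integral>x. ?V js (max y (min x (\<sigma> j))) \<partial>?E)" for y
    proof (cases "y > \<sigma> j")
      case True
      then have "max y (min x (\<sigma> j)) = y" for x by auto
      then show ?thesis using True fix_above[of y] prob_space by simp
    next
      case False
      then show ?thesis
        using integral_capped[OF E price mono fix_above, of y] by simp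
    qed
    have "mono (?V (j # js))"
      unfolding V[abs_def] mono_def V
      by (intro allI impI distribution01_integral_mono[OF E int int] monoD[OF mono]) auto
    moreover have "y \<le> ?V (j # js) y" for y
    proof -
      have "y \<le> ?V js (max y (min x (\<sigma> j)))" for x
        using ge[of "max y (min x (\<sigma> j))"] by simp
      then show ?thesis
        unfolding V by (intro integral_ge_const int) simp
    qed
    moreover have "?V (j # js) y = y" if "\<forall>i\<in>set (j # js). \<sigma> i \<le> y" for y
    proof -
      have "max y (min x (\<sigma> j)) = y" for x using that by auto
      then show ?thesis unfolding V using fix1[of y] that prob_space by simp
    qed
    \<comment> \<open>Not an instance of the previous property: a price above 1 can occur when the
      cost is 0. The reason here is that observations in \<open>{0..1}\<close> cannot raise
      \<open>y\<close>.\<close>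
    moreover have "?V (j # js) y = y" if "1 \<le> y" for y
    proof -
      have "?V (j # js) y = (\<integral>x. y \<partial>?E)"
        unfolding V
      proof (rule distribution01_integral_cong[OF E meas])
        fix x :: real assume "x \<in> {0..1}"
        then have "max y (min x (\<sigma> j)) = y" using that by auto
        then show "?V js (max y (min x (\<sigma> j))) = y" using fix2[OF that] by simp
      qed simp
      then show ?thesis using prob_space by simp
    qed
    ultimately show ?case by blast
  qed
  then show "mono (continuation_value c \<sigma> D js)"
    and "\<And>y. y \<le> continuation_value c \<sigma> D js y"
    and "\<And>y. (\<And>j. j \<in> set js \<Longrightarrow> \<sigma> j \<le> y) \<Longrightarrow> continuation_value c \<sigma> D js y = y"
    and "\<And>y. 1 \<le> y \<Longrightarrow> continuation_value c \<sigma> D js y = y"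
    by auto
qed

section \<open>Exchanging the distributions\<close>

text \<open>The intermediate term integrates the continuation for \<open>D\<close> under
  \<open>D' j\<close>. Changing the first box thus involves only \<open>?V\<close>, for which the
  prices are the right ones; \<open>?V'\<close> need not be monotone and is compared with
  \<open>?V\<close> by induction, at the observation \<open>max y x\<close>.\<close>

lemma continuation_value_diff_le:
  assumes "\<And>j. j \<in> set js \<Longrightarrow> continuous_distribution01 (D j)"
    and "\<And>j. j \<in> set js \<Longrightarrow> continuous_distribution01 (D' j)"
    and "\<And>j. j \<in> set js \<Longrightarrow> is_reservation_price (D j) (c j) (\<sigma> j)"
    and "\<And>j. j \<in> set js \<Longrightarrow> kolmogorov_dist (D j) (D' j) \<le> \<epsilon>"
    and "sorted_wrt (\<lambda>i j. \<sigma> i \<ge> \<sigma> j) js"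
    and "y \<in> {0..1}" and "0 \<le> \<epsilon>"
  shows "\<bar>continuation_value c \<sigma> D js y - continuation_value c \<sigma> D' js y\<bar> \<le> real (length js) * \<epsilon>"
  using assms
proof (induction js arbitrary: y)
  case Nil
  then show ?case by simp
next
  case (Cons j js)
  let ?V = "continuation_value c \<sigma> D js" and ?V' = "continuation_value c \<sigma> D' js"
  have Dj: "continuous_distribution01 (D j)" and D'j: "continuous_distribution01 (D' j)"
    using Cons.prems by simp_all
  have y: "y \<in> {0..1}" by fact
  have mono: "mono ?V" and ge: "\<And>z. z \<le> ?V z" and one: "?V 1 = 1"
    using Cons.prems by (intro continuation_value_optimal; simp)+
  have "\<bar>(\<integral>x. ?V (max y x) \<partial>D j) - (\<integral>x. ?V (max y x) \<partial>D' j)\<bar> \<le> kolmogorov_dist (D j) (D' j)"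
  proof (rule integral_mono_diff_le_kolmogorov_dist[OF Dj D'j])
    show "mono (\<lambda>x. ?V (max y x))"
      by (intro monoI monoD[OF mono]) auto
    fix x :: real assume "x \<in> {0..1}"
    \<comment> \<open>The lower bound comes from \<open>ge\<close>, the upper one from monotonicity
      and \<open>?V 1 = 1\<close>.\<close>
    then show "?V (max y x) \<in> {0..1}"
      using ge[of "max y x"] monoD[OF mono, of "max y x" 1] one y by auto
  qed
  also have "\<dots> \<le> \<epsilon>" using Cons.prems by simp
  finally have change_first: "\<bar>(\<integral>x. ?V (max y x) \<partial>D j) - (\<integral>x. ?V (max y x) \<partial>D' j)\<bar> \<le> \<epsilon>" .
  have ints: "integrable (D' j) (\<lambda>x. ?V (max y x))" "integrable (D' j) (\<lambda>x. ?V' (max y x))"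
    using Cons.prems by (intro continuation_value_integrable; simp)+
  have [measurable]: "?V \<in> borel_measurable borel" "?V' \<in> borel_measurable borel"
    using Cons.prems by (intro continuation_value_measurable; simp)+
  let ?b = "real (length js) * \<epsilon>"
  have "- ?b \<le> ?V (max y x) - ?V' (max y x) \<and> ?V (max y x) - ?V' (max y x) \<le> ?b"
    if "x \<in> {0..1}" for x
  proof -
    have "\<bar>?V (max y x) - ?V' (max y x)\<bar> \<le> ?b"
      using Cons.prems that by (intro Cons.IH) auto
    then show ?thesis by linarith
  qed
  moreover have "(\<lambda>x. ?V (max y x) - ?V' (max y x)) \<in> borel_measurable borel" by measurable
  ultimately have "- ?b \<le> (\<integral>x. ?V (max y x) - ?V' (max y x) \<partial>D' j)"
    "(\<integral>x. ?V (max y x) - ?V' (max y x) \<partial>D' j) \<le> ?b"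
    by (intro distribution01_integral[OF D'j]; blast)+
  then have change_rest: "\<bar>(\<integral>x. ?V (max y x) \<partial>D' j) - (\<integral>x. ?V' (max y x) \<partial>D' j)\<bar> \<le> ?b"
    using ints by simp
  have "0 \<le> ?b" using Cons.prems by simp
  show ?case
  proof (cases "y > \<sigma> j")
    case True
    then show ?thesis using \<open>0 \<le> ?b\<close> \<open>0 \<le> \<epsilon>\<close> by (simp add: algebra_simps)
  next
    case False
    then show ?thesis using change_first change_rest by (simp add: algebra_simps)
  qed
qed

section \<open>Expected utility as a continuation value\<close>

text \<open>Pathwise counterpart of \<open>continuation_value\<close>, with the set of opened boxes
  condensed to its best value \<open>y\<close>.\<close>

fun realized_value ::
    "(nat \<Rightarrow> real) \<Rightarrow> (nat \<Rightarrow> real) \<Rightarrow> nat list \<Rightarrow> real \<Rightarrow> (nat \<Rightarrow> real) \<Rightarrow> real" where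
  "realized_value c \<tau> [] y x = y"
| "realized_value c \<tau> (j # js) y x =
     (if y > \<tau> j then y else realized_value c \<tau> js (max y (x j)) x - c j)"

lemma realized_value_cong:
  "(\<And>j. j \<in> set js \<Longrightarrow> x j = x' j) \<Longrightarrow> realized_value c \<tau> js y x = realized_value c \<tau> js y x'"
  by (induction js arbitrary: y) auto

lemma realized_value_bounded:
  assumes "\<And>j. j \<in> set js \<Longrightarrow> x j \<in> {0..1}" and "y \<in> {0..1}"
  shows "\<bar>realized_value c \<tau> js y x\<bar> \<le> 1 + total_cost c js"
  using assms
proof (induction js arbitrary: y)
  case Nil
  then show ?case by simp
next
  case (Cons j js)
  have "\<bar>realized_value c \<tau> js (max y (x j)) x\<bar> \<le> 1 + total_cost c js"
    using Cons.prems Cons.prems(1)[of j] by (intro Cons.IH) auto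
  then show ?case
    using Cons.prems(2) total_cost_nonneg[of c js] by auto
qed

text \<open>The start \<open>f\<close> varies with \<open>w\<close> because the recursion replaces
  it by a maximum with an observation; \<open>X\<close> and \<open>M\<close> are general so that the
  product space and its splitting into a pair are both covered.\<close>

lemma realized_value_measurable:
  assumes "\<And>j. j \<in> set js \<Longrightarrow> (\<lambda>w. X w j) \<in> borel_measurable M"
    and "f \<in> borel_measurable M"
  shows "(\<lambda>w. realized_value c \<tau> js (f w) (X w)) \<in> borel_measurable M"
  using assms
proof (induction js arbitrary: f)
  case Nil
  then show ?case by simp
next
  case (Cons j js)
  have [measurable]: "f \<in> borel_measurable M" "(\<lambda>w. X w j) \<in> borel_measurable M"
    using Cons.prems by simp_all
  have [measurable]: "(\<lambda>w. realized_value c \<tau> js (max (f w) (X w j)) (X w)) \<in> borel_measurable M"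
    using Cons.prems by (intro Cons.IH) simp_all
  show ?case by simp
qed

lemma best_value_empty: "best_value x {} = 0"
  and best_value_singleton: "best_value x {j} = x j"
  by (simp_all add: best_value_def)

lemma best_value_insert:
  assumes "finite S" and "S \<noteq> {}"
  shows "best_value x (insert j S) = max (best_value x S) (x j)"
  using assms by (simp add: best_value_def max.commute)

text \<open>For nonempty \<open>S\<close>, opening a box changes the best value by a maximum;
  disjointness ensures that each new cost is added to the sum over \<open>S\<close> exactly
  once.\<close>

lemma utility_eq_realized_value:
  assumes "finite S" and "S \<noteq> {}" and "distinct js" and "set js \<inter> S = {}"
  shows "best_value x (opened_boxes \<tau> x S js) - (\<Sum>i\<in>opened_boxes \<tau> x S js. c i)
    = realized_value c \<tau> js (best_value x S) x - (\<Sum>i\<in>S. c i)"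
  using assms
  by (induction js arbitrary: S) (auto simp: best_value_insert)

text \<open>The first observation replaces the outside option \<open>0\<close> even if it is negative, whereas
  \<^const>\<open>realized_value\<close> keeps the maximum of both; they agree only for nonnegative values.\<close>

lemma alg_utility_simps:
  "alg_utility c \<tau> [] x = 0"
  "distinct (j # js) \<Longrightarrow> alg_utility c \<tau> (j # js) x =
    (if 0 > \<tau> j then 0 else realized_value c \<tau> js (x j) x - c j)"
  using utility_eq_realized_value[of "{j}" js x \<tau> c]
  by (auto simp: alg_utility_def Let_def best_value_empty best_value_singleton)

lemma alg_utility_eq_realized_value:
  assumes "distinct ord" and "\<And>j. j \<in> set ord \<Longrightarrow> 0 \<le> x j"
  shows "alg_utility c \<tau> ord x = realized_value c \<tau> ord 0 x"
  using assms by (cases ord) (auto simp: alg_utility_simps)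

text \<open>Measurability concerns the whole space, including negative values, so the first box is
  unfolded and its observation \<open>x j\<close> itself is the start.\<close>

lemma alg_utility_measurable:
  assumes "distinct ord" and "\<And>j. j \<in> set ord \<Longrightarrow> (\<lambda>x. x j) \<in> borel_measurable M"
  shows "alg_utility c \<tau> ord \<in> borel_measurable M"
proof (cases ord)
  case Nil
  then show ?thesis by (simp add: alg_utility_simps(1)[abs_def])
next
  case (Cons j js)
  have [measurable]: "(\<lambda>x. realized_value c \<tau> js (x j) x) \<in> borel_measurable M"
    using assms Cons by (intro realized_value_measurable) auto
  have "alg_utility c \<tau> ord =
      (\<lambda>x. if 0 > \<tau> j then 0 else realized_value c \<tau> js (x j) x - c j)"
    using assms(1) Cons by (intro ext) (simp only: alg_utility_simps)
  then show ?thesis by simp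
qed

section \<open>Integration over the product measure\<close>

lemma PiM_AE_unit:
  assumes "\<And>i. continuous_distribution01 (D i)" and "finite I"
  shows "AE x in PiM I D. \<forall>i\<in>I. x i \<in> {0..1}"
proof (rule AE_finite_allI[OF \<open>finite I\<close>])
  fix i assume "i \<in> I"
  with assms show "AE x in PiM I D. x i \<in> {0..1}"
    by (intro AE_PiM_component continuous_distribution01D)
      (auto intro: real_distribution.axioms continuous_distribution01D)
qed

lemma PiM_component_borel:
  assumes "\<And>i. continuous_distribution01 (D i)" and "i \<in> I"
  shows "(\<lambda>x. x i) \<in> borel_measurable (PiM I D)"
proof -
  interpret real_distribution "D i" using assms by (intro continuous_distribution01D)
  have "measurable (PiM I D) (D i) = borel_measurable (PiM I D)"
    by (intro measurable_cong_sets) simp_all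
  then show ?thesis
    using measurable_component_singleton[OF assms(2), of D] by simp
qed

text \<open>Fubini along the list: coordinate \<open>j\<close> is split off the product, and for
  each of its values \<open>t\<close> the inner integral is the induction hypothesis with start
  \<open>max y t\<close>.\<close>

lemma integral_realized_value:
  assumes D: "\<And>i. continuous_distribution01 (D i)" and "distinct js" and "y \<in> {0..1}"
  shows "(\<integral>x. realized_value c \<tau> js y x \<partial>PiM (set js) D) = continuation_value c \<tau> D js y"
proof -
  interpret P: product_prob_space D
    by (rule product_prob_spaceI) (use D continuous_distribution01D(1) real_distribution.axioms in blast)
  have PiM: "prob_space (PiM I D)" for I
    by (intro prob_space_PiM P.prob_space)
  show ?thesis
    using assms(2,3)
  proof (induction js arbitrary: y)
    case Nil
    then show ?case by (simp add: prob_space.prob_space[OF PiM])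
  next
    case (Cons j js)
    interpret real_distribution "D j" using D by (rule continuous_distribution01D)
    interpret J: prob_space "PiM (set js) D" by (rule PiM)
    interpret L: prob_space "PiM (set (j # js)) D" by (rule PiM)
    let ?u = "realized_value c \<tau>"
    have meas: "(\<lambda>x. ?u ks z x) \<in> borel_measurable (PiM (set ks) D)" for ks z
      using D by (intro realized_value_measurable PiM_component_borel) auto
    have bdd: "AE x in PiM (set ks) D. norm (?u ks z x) \<le> 1 + total_cost c ks"
      if "z \<in> {0..1}" for ks z
      using PiM_AE_unit[OF D, of "set ks"]
      by (rule AE_mp) (use that in \<open>auto intro!: AE_I2 realized_value_bounded\<close>)
    show ?case
    proof (cases "y > \<tau> j")
      case True
      then show ?thesis using L.prob_space by simp
    next
      case False
      have int: "integrable (PiM ({j} \<union> set js) D) (\<lambda>x. ?u (j # js) y x)"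
        using L.integrable_const_bound[OF bdd[OF Cons.prems(2)] meas] by simp
      \<comment> \<open>By distinctness the later boxes never read coordinate \<open>j\<close>, so
        they see only \<open>b\<close>.\<close>
      have step: "?u (j # js) y (merge {j} (set js) (a, b)) = ?u js (max y (a j)) b - c j" for a b
      proof -
        have "?u js (max y (a j)) (merge {j} (set js) (a, b)) = ?u js (max y (a j)) b"
          using Cons.prems(1) by (intro realized_value_cong) (auto simp: merge_def)
        then show ?thesis using False by (simp add: merge_def)
      qed
      \<comment> \<open>Joint measurability makes the inner integral measurable in \<open>t\<close>,
        which is needed to pass from \<open>PiM {j} D\<close> to \<open>D j\<close>.\<close>
      have "(\<lambda>(t, b). ?u js (max y t) b - c j) \<in> borel_measurable (D j \<Otimes>\<^sub>M PiM (set js) D)"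
        unfolding case_prod_beta
        by (intro borel_measurable_diff realized_value_measurable borel_measurable_const
            measurable_compose[OF measurable_snd PiM_component_borel] D) simp_all
      then have joint: "(\<lambda>t. \<integral>b. ?u js (max y t) b - c j \<partial>PiM (set js) D) \<in> borel_measurable (D j)"
        by (rule J.borel_measurable_lebesgue_integral)
      have "(\<integral>x. ?u (j # js) y x \<partial>PiM (set (j # js)) D)
          = (\<integral>a. (\<integral>b. ?u (j # js) y (merge {j} (set js) (a, b)) \<partial>PiM (set js) D) \<partial>PiM {j} D)"
        using P.product_integral_fold[OF _ _ _ int] Cons.prems(1) by simp
      also have "\<dots> = (\<integral>a. (\<integral>b. ?u js (max y (a j)) b - c j \<partial>PiM (set js) D) \<partial>PiM {j} D)"
        by (simp only: step)
      also have "\<dots> = (\<integral>t. (\<integral>b. ?u js (max y t) b - c j \<partial>PiM (set js) D) \<partial>D j)"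
        by (rule P.product_integral_singleton[OF joint])
      also have "\<dots> = (\<integral>t. continuation_value c \<tau> D js (max y t) - c j \<partial>D j)"
      proof (rule integral_cong_AE)
        \<comment> \<open>Equality is claimed almost everywhere because the induction hypothesis
          needs \<open>max y t\<close> in the unit interval.\<close>
        show "AE t in D j. (\<integral>b. ?u js (max y t) b - c j \<partial>PiM (set js) D)
            = continuation_value c \<tau> D js (max y t) - c j"
          using continuous_distribution01D(2)[OF D]
        proof eventually_elim
          case (elim t)
          then have z: "max y t \<in> {0..1}" using Cons.prems(2) by auto
          have "integrable (PiM (set js) D) (\<lambda>b. ?u js (max y t) b)"
            by (rule J.integrable_const_bound[OF bdd[OF z] meas])
          then show ?case
            using Cons.IH[OF _ z] Cons.prems(1) J.prob_space by simp
        qed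
        have "continuation_value c \<tau> D js \<in> borel_measurable borel"
          using D by (rule continuation_value_measurable)
        then show "(\<lambda>t. continuation_value c \<tau> D js (max y t) - c j) \<in> borel_measurable (D j)"
          by measurable
      qed (rule joint)
      also have "\<dots> = continuation_value c \<tau> D (j # js) y"
        using continuation_value_integrable[OF D Cons.prems(2) D] False
          prob_space.prob_space[OF P.prob_space, of j] by simp
      finally show ?thesis .
    qed
  qed
qed

text \<open>Observations are almost surely nonnegative, so the outside option \<open>0\<close> can
  be treated like an earlier observation.\<close>

lemma expected_utility_eq_continuation_value:
  assumes D: "\<And>i. i < n \<Longrightarrow> continuous_distribution01 (D i)"
    and n: "n \<ge> 1" and ord: "distinct ord" "set ord = {..<n}"
  shows "expected_utility n c \<tau> ord D = continuation_value c \<tau> D ord 0"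
proof -
  \<comment> \<open>The product measure locales require every \<open>D i\<close>, also for \<open>i \<ge> n\<close>, to be a probability measure.\<close>
  define E where "E i = (if i < n then D i else D 0)" for i
  have E: "continuous_distribution01 (E i)" for i
    using D n by (simp add: E_def)
  have "PiM {..<n} D = PiM {..<n} E"
    by (rule PiM_cong) (auto simp: E_def)
  then have "expected_utility n c \<tau> ord D = (\<integral>x. alg_utility c \<tau> ord x \<partial>PiM (set ord) E)"
    by (simp add: expected_utility_def ord)
  also have "\<dots> = (\<integral>x. realized_value c \<tau> ord 0 x \<partial>PiM (set ord) E)"
  proof (rule integral_cong_AE)
    show "AE x in PiM (set ord) E. alg_utility c \<tau> ord x = realized_value c \<tau> ord 0 x"
      using PiM_AE_unit[OF E, of "set ord"]
      by (rule AE_mp) (use ord in \<open>auto intro!: AE_I2 alg_utility_eq_realized_value\<close>)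
    show "alg_utility c \<tau> ord \<in> borel_measurable (PiM (set ord) E)"
      using ord E by (intro alg_utility_measurable PiM_component_borel)
    show "(\<lambda>x. realized_value c \<tau> ord 0 x) \<in> borel_measurable (PiM (set ord) E)"
      using E by (intro realized_value_measurable PiM_component_borel) auto
  qed
  also have "\<dots> = continuation_value c \<tau> E ord 0"
    using E ord by (intro integral_realized_value) auto
  also have "\<dots> = continuation_value c \<tau> D ord 0"
    using ord by (intro continuation_value_cong) (simp add: E_def)
  finally show ?thesis .
qed

theorem theorem1:
  "\<exists>C::real. \<forall>(n::nat) (c :: nat \<Rightarrow> real) (D :: nat \<Rightarrow> real measure) (D' :: nat \<Rightarrow> real measure)
      (\<sigma> :: nat \<Rightarrow> real) (ord :: nat list) (\<epsilon> :: real).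
     n \<ge> 1 \<longrightarrow>
     (\<forall>i<n. c i \<ge> 0) \<longrightarrow>
     (\<forall>i<n. continuous_distribution01 (D i)) \<longrightarrow>
     (\<forall>i<n. continuous_distribution01 (D' i)) \<longrightarrow>
     (\<forall>i<n. is_reservation_price (D i) (c i) (\<sigma> i)) \<longrightarrow>
     (\<forall>i<n. kolmogorov_dist (D i) (D' i) \<le> \<epsilon>) \<longrightarrow>
     decreasing_order n \<sigma> ord \<longrightarrow>
     \<bar>expected_utility n c \<sigma> ord D - expected_utility n c \<sigma> ord D'\<bar> \<le> C * real n * \<epsilon>"
proof (intro exI[of _ 1] allI impI)
  fix n :: nat and c \<sigma> :: "nat \<Rightarrow> real" and D D' :: "nat \<Rightarrow> real measure"
    and ord :: "nat list" and \<epsilon> :: real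
  assume n: "n \<ge> 1"
    and D: "\<forall>i<n. continuous_distribution01 (D i)"
    and D': "\<forall>i<n. continuous_distribution01 (D' i)"
    and price: "\<forall>i<n. is_reservation_price (D i) (c i) (\<sigma> i)"
    and dist: "\<forall>i<n. kolmogorov_dist (D i) (D' i) \<le> \<epsilon>"
    and "decreasing_order n \<sigma> ord"
  then have ord: "distinct ord" "set ord = {..<n}" "sorted_wrt (\<lambda>i j. \<sigma> i \<ge> \<sigma> j) ord"
    by (auto simp: decreasing_order_def)
  have len: "length ord = n"
    using distinct_card[OF ord(1)] ord(2) by simp
  \<comment> \<open>Nonnegativity of \<open>\<epsilon>\<close> is read off from box
    \<open>0\<close>, which exists since \<open>n \<ge> 1\<close>.\<close>
  have "0 \<le> \<bar>cdf (D 0) 0 - cdf (D' 0) 0\<bar>" by simp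
  also have "\<dots> \<le> kolmogorov_dist (D 0) (D' 0)"
    using D D' n by (intro cdf_diff_le_kolmogorov_dist) auto
  also have "\<dots> \<le> \<epsilon>" using dist n by simp
  finally have "0 \<le> \<epsilon>" .
  then have "\<bar>continuation_value c \<sigma> D ord 0 - continuation_value c \<sigma> D' ord 0\<bar>
      \<le> real (length ord) * \<epsilon>"
    using D D' price dist ord by (intro continuation_value_diff_le) auto
  moreover have "expected_utility n c \<sigma> ord D = continuation_value c \<sigma> D ord 0"
    using D n ord by (intro expected_utility_eq_continuation_value) auto
  moreover have "expected_utility n c \<sigma> ord D' = continuation_value c \<sigma> D' ord 0"
    using D' n ord by (intro expected_utility_eq_continuation_value) auto
  ultimately show "\<bar>expected_utility n c \<sigma> ord D - expected_utility n c \<sigma> ord D'\<bar>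
      \<le> 1 * real n * \<epsilon>"
    by (simp add: len)
qed

end
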